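(* For an integer $k\ge 1$, let $R_k(p)=\sum_{m\ge 0} r_{k,m}p^m$ be the generating function of plateau polycubes of width $k$ according to the lateral area, where $r_{k,m}$ is the number of plateau polycubes of width $k$ and lateral area $m$. Then, as formal power series, $$R_k(p)=C_{k-1}(p)^2,$$ where, for $k\ge 0$, $$C_k(p)=\frac{p^{k+1}}{(1-p)^{2k+1}}\sum_{i=0}^{k}D_{k-i,i}\,p^i,$$ and $D_{n,m}$ denotes the Delannoy number.
   Context: A cell is a unit cube of the lattice $\mathbb{Z}^3$ with orthonormal coordinate system $(0,\vec i,\vec j,\vec k)$. A polycube is a finite (nonempty) union of cells, connected through their faces, and considered up to translation. Its width is the difference between its greatest and smallest indices (coordinates of its points) in the direction $\vec i$, i.e. the number of layers of cells it occupies in direction $\vec i$. A stratum is a polycube of width $1$; a plateau is a rectangular stratum (a full $1\times b\times c$ block of cells, of extent $1$ in direction $\vec i$). A plateau polycube is a polycube whose strata (its intersections with the successive unit-width layers orthogonal to $\vec i$) are all plateaus. The lateral area of a polycube is the sum of the areas (numbers of unit squares) of its projections onto the planes $(\vec i,\vec j)$ and $(\vec i,\vec k)$. The Delannoy number $D_{n,m}=D(n,m)$, $n,m\ge 0$, is the number of lattice paths from $(0,0)$ to $(n,m)$ made only of steps $(1,0)$, $(0,1)$ and $(1,1)$; equivalently $D(n,m)=\sum_{k=0}^m\binom{m}{k}\binom{n+m-k}{m}$. *)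

theory Defs
  imports
    "HOL-Library.Product_Plus"
    "HOL-Computational_Algebra.Formal_Power_Series"
begin

text \<open>
  The triple \<open>(x, y, z)\<close> stands for the cell \<open>[x,x+1] \<times> [y,y+1] \<times> [z,z+1]\<close>; a finite union of
  cells is represented by the finite set of these triples.
\<close>

type_synonym cell = "int \<times> int \<times> int"

fun face_adjacent :: "cell \<Rightarrow> cell \<Rightarrow> bool" where
  "face_adjacent (x, y, z) (x', y', z') \<longleftrightarrow> \<bar>x - x'\<bar> + \<bar>y - y'\<bar> + \<bar>z - z'\<bar> = 1"

definition face_connected :: "cell set \<Rightarrow> bool" where
  "face_connected P \<longleftrightarrow>
     (\<forall>a\<in>P. \<forall>b\<in>P. (a, b) \<in> {(c, d). c \<in> P \<and> d \<in> P \<and> face_adjacent c d}\<^sup>*)"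

definition polycube :: "cell set \<Rightarrow> bool" where
  "polycube P \<longleftrightarrow> finite P \<and> P \<noteq> {} \<and> face_connected P"

definition translation_rel :: "cell set rel" where
  "translation_rel = {(P, Q). \<exists>v. Q = (\<lambda>c. v + c) ` P}"

lemma equiv_translation_rel: "equiv UNIV translation_rel"
proof (rule equivI)
  show "translation_rel \<subseteq> UNIV \<times> UNIV" by simp
  show "refl translation_rel"
  proof (rule reflI)
    fix P :: "cell set"
    have "P = (\<lambda>c. 0 + c) ` P" by simp
    then show "(P, P) \<in> translation_rel" unfolding translation_rel_def by blast
  qed
  show "sym translation_rel"
  proof (rule symI)
    fix P Q assume "(P, Q) \<in> translation_rel"
    then obtain v where "Q = (\<lambda>c. v + c) ` P" by (auto simp: translation_rel_def)
    then have "P = (\<lambda>c. - v + c) ` Q" by (simp add: image_image)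
    then show "(Q, P) \<in> translation_rel" unfolding translation_rel_def by blast
  qed
  show "trans translation_rel"
  proof (rule transI)
    fix P Q R assume "(P, Q) \<in> translation_rel" "(Q, R) \<in> translation_rel"
    then obtain v w where "Q = (\<lambda>c. v + c) ` P" "R = (\<lambda>c. w + c) ` Q"
      by (auto simp: translation_rel_def)
    then have "R = (\<lambda>c. (w + v) + c) ` P" by (simp add: image_image add.assoc)
    then show "(P, R) \<in> translation_rel" unfolding translation_rel_def by blast
  qed
qed

text \<open>The points of the cell \<open>(x, y, z)\<close> have first coordinates from \<open>x\<close> to \<open>x + 1\<close>.\<close>

definition width :: "cell set \<Rightarrow> int" where
  "width P = Max ((\<lambda>(x, y, z). x + 1) ` P) - Min ((\<lambda>(x, y, z). x) ` P)"

definition stratum :: "cell set \<Rightarrow> bool" where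
  "stratum P \<longleftrightarrow> polycube P \<and> width P = 1"

definition plateau :: "cell set \<Rightarrow> bool" where
  "plateau P \<longleftrightarrow> stratum P \<and> (\<exists>x y y' z z'. P = {x} \<times> {y..y'} \<times> {z..z'})"

definition strata :: "cell set \<Rightarrow> cell set set" where
  "strata P = (\<lambda>x. P \<inter> {x} \<times> UNIV) ` fst ` P"

definition plateau_polycube :: "cell set \<Rightarrow> bool" where
  "plateau_polycube P \<longleftrightarrow> polycube P \<and> (\<forall>S\<in>strata P. plateau S)"

definition lateral_area :: "cell set \<Rightarrow> nat" where
  "lateral_area P = card ((\<lambda>(x, y, z). (x, y)) ` P) + card ((\<lambda>(x, y, z). (x, z)) ` P)"

text \<open>Width, lateral area and the plateau property are translation invariant, so each
  equivalence class below consists of sets satisfying the same three conditions.\<close>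

definition num_plateau_polycubes :: "nat \<Rightarrow> nat \<Rightarrow> nat" where
  "num_plateau_polycubes k m =
     card ({P. plateau_polycube P \<and> width P = int k \<and> lateral_area P = m} // translation_rel)"

definition R_gf :: "nat \<Rightarrow> rat fps" where
  "R_gf k = Abs_fps (\<lambda>m. of_nat (num_plateau_polycubes k m))"

text \<open>A lattice path starting at \<open>(0, 0)\<close> is the list of its steps.\<close>

definition delannoy :: "nat \<Rightarrow> nat \<Rightarrow> nat" where
  "delannoy n m =
     card {ss :: (nat \<times> nat) list. set ss \<subseteq> {(1, 0), (0, 1), (1, 1)} \<and> sum_list ss = (n, m)}"

definition C_gf :: "nat \<Rightarrow> rat fps" where
  "C_gf k = fps_X ^ (k + 1) / (1 - fps_X) ^ (2 * k + 1)
              * (\<Sum>i = 0..k. of_nat (delannoy (k - i) i) * fps_X ^ i)"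

end

theory Submission
  imports Defs
begin

text \<open>
  A plateau polycube of width \<open>k\<close> is a stack of \<open>k\<close> rectangles. Two consecutive rectangles share a
  face exactly if their projections to the second axis meet and their projections to the third axis
  meet. So a plateau polycube is the same as a pair of \<^emph>\<open>interval chains\<close> of length \<open>k\<close>: sequences
  of nonempty integer intervals in which neighbours intersect. The two chains are independent, their
  translations are the translations of the polycube in the two directions, and the lateral area is the
  sum of all interval lengths. This bijection (\<open>plateau_polycube_solid\<close>,
  \<open>plateau_polycube_imp_solid\<close>, \<open>num_plateau_polycubes_eq\<close>) explains the square: \<open>R_gf k\<close> is the
  square of the generating function of interval chains of length \<open>k\<close>, up to translation, by total
  length.
  
  For one chain, an interval of length \<open>l'\<close> can be attached to an interval of length \<open>l\<close> in
  \<open>l + l' - 1\<close> positions. This number is affine in \<open>l\<close>, hence so is the generating function of all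
  continuations by \<open>k\<close> intervals, \<open>l * slope_gf k + offset_gf k\<close> (\<open>finite_card_continuations\<close>).
  Slope and offset satisfy a linear recurrence with a \<open>2 \<times> 2\<close> matrix, and its characteristic
  polynomial gives
  \<open>slope_gf (k + 2) = X (1 + X) / (1 - X)\<^sup>2 * slope_gf (k + 1) + X ^ 3 / (1 - X) ^ 4 * slope_gf k\<close>
  (\<open>slope_gf_rec\<close>). On the other side, the antidiagonal polynomials \<open>P k = (\<Sum>i\<le>k. D (k - i) i * X ^ i)\<close>
  of the Delannoy table satisfy \<open>P (k + 2) = (1 + X) * P (k + 1) + X * P k\<close> (\<open>delannoy_diag_rec\<close>),
  and the powers of \<open>X\<close> and \<open>1 - X\<close> in \<open>C_gf k\<close> turn this into the recurrence above. Hence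
  \<open>C_gf k = slope_gf (k + 1)\<close> (\<open>C_gf_eq_slope_gf\<close>), and this is also the generating function of the
  chains of \<open>k + 1\<close> intervals up to translation (\<open>finite_card_normal_chains\<close>).
\<close>

unbundle fps_syntax

section \<open>Antidiagonals of the Delannoy table\<close>

definition delannoy_paths :: "nat \<Rightarrow> nat \<Rightarrow> (nat \<times> nat) list set" where
  "delannoy_paths n m = {ss. set ss \<subseteq> {(1, 0), (0, 1), (1, 1)} \<and> sum_list ss = (n, m)}"

lemma delannoy_eq_card: "delannoy n m = card (delannoy_paths n m)"
  by (simp add: delannoy_def delannoy_paths_def)

text \<open>
  Splitting off the first step of a path is what turns the count into the three-term recurrence.
\<close>

lemma delannoy_paths_Cons:
  "(s # ss \<in> delannoy_paths n m) \<longleftrightarrow>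
     (s = (1, 0) \<and> (\<exists>n'. n = Suc n' \<and> ss \<in> delannoy_paths n' m)) \<or>
     (s = (0, 1) \<and> (\<exists>m'. m = Suc m' \<and> ss \<in> delannoy_paths n m')) \<or>
     (s = (1, 1) \<and> (\<exists>n' m'. n = Suc n' \<and> m = Suc m' \<and> ss \<in> delannoy_paths n' m'))"
  by (cases "sum_list ss") (auto simp: delannoy_paths_def)

lemma delannoy_paths_Nil: "[] \<in> delannoy_paths n m \<longleftrightarrow> n = 0 \<and> m = 0"
  by (auto simp: delannoy_paths_def zero_prod_def)

lemma delannoy_paths_0_0: "delannoy_paths 0 0 = {[]}"
proof (rule set_eqI)
  fix ss show "ss \<in> delannoy_paths 0 0 \<longleftrightarrow> ss \<in> {[]}"
    by (cases ss) (auto simp: delannoy_paths_Cons delannoy_paths_Nil)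
qed

lemma delannoy_paths_Suc_0: "delannoy_paths (Suc n) 0 = Cons (1, 0) ` delannoy_paths n 0"
proof (rule set_eqI)
  fix ss show "ss \<in> delannoy_paths (Suc n) 0 \<longleftrightarrow> ss \<in> Cons (1, 0) ` delannoy_paths n 0"
    by (cases ss) (auto simp: delannoy_paths_Cons delannoy_paths_Nil)
qed

lemma delannoy_paths_0_Suc: "delannoy_paths 0 (Suc m) = Cons (0, 1) ` delannoy_paths 0 m"
proof (rule set_eqI)
  fix ss show "ss \<in> delannoy_paths 0 (Suc m) \<longleftrightarrow> ss \<in> Cons (0, 1) ` delannoy_paths 0 m"
    by (cases ss) (auto simp: delannoy_paths_Cons delannoy_paths_Nil)
qed

lemma delannoy_paths_Suc_Suc:
  "delannoy_paths (Suc n) (Suc m) =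
     Cons (1, 0) ` delannoy_paths n (Suc m) \<union> Cons (0, 1) ` delannoy_paths (Suc n) m
       \<union> Cons (1, 1) ` delannoy_paths n m"
proof (rule set_eqI)
  fix ss
  show "ss \<in> delannoy_paths (Suc n) (Suc m) \<longleftrightarrow>
    ss \<in> Cons (1, 0) ` delannoy_paths n (Suc m) \<union> Cons (0, 1) ` delannoy_paths (Suc n) m
       \<union> Cons (1, 1) ` delannoy_paths n m"
    by (cases ss) (auto simp: delannoy_paths_Cons delannoy_paths_Nil)
qed

lemma delannoy_0_right: "delannoy n 0 = 1"
  by (induction n)
     (simp_all add: delannoy_eq_card delannoy_paths_0_0 delannoy_paths_Suc_0 card_image)

lemma delannoy_0_left: "delannoy 0 m = 1"
  by (induction m)
     (simp_all add: delannoy_eq_card delannoy_paths_0_0 delannoy_paths_0_Suc card_image)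

lemma finite_delannoy_paths: "finite (delannoy_paths n m)"
proof (induction "n + m" arbitrary: n m rule: less_induct)
  case less
  show ?case
    by (cases n; cases m)
       (auto simp: delannoy_paths_0_0 delannoy_paths_Suc_0 delannoy_paths_0_Suc
          delannoy_paths_Suc_Suc less)
qed

lemma delannoy_Suc_Suc:
  "delannoy (Suc n) (Suc m) = delannoy n (Suc m) + delannoy (Suc n) m + delannoy n m"
  unfolding delannoy_eq_card delannoy_paths_Suc_Suc
  by (subst card_Un_disjoint | auto simp: finite_delannoy_paths card_image)+

text \<open>
  The polynomial in the numerator of \<open>C_gf k\<close>: its coefficients run along the antidiagonal
  \<open>n + m = k\<close> of the Delannoy table.
\<close>

definition delannoy_diag :: "nat \<Rightarrow> rat fps" where
  "delannoy_diag k = (\<Sum>i = 0..k. of_nat (delannoy (k - i) i) * fps_X ^ i)"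

lemma delannoy_diag_nth:
  "delannoy_diag k $ i = (if i \<le> k then of_nat (delannoy (k - i) i) else 0)"
proof -
  have "delannoy_diag k $ i
      = (\<Sum>j = 0..k. if i = j then of_nat (delannoy (k - j) j) else 0)"
    unfolding delannoy_diag_def fps_sum_nth
    by (rule sum.cong) (auto simp: fps_of_nat [symmetric] fps_X_power_iff)
  then show ?thesis by simp
qed

text \<open>
  Of the three possible first steps, the steps \<open>(1, 0)\<close> and \<open>(0, 1)\<close> lead to the previous
  antidiagonal and the diagonal step to the one before it. The exponent \<open>i\<close> records the second
  coordinate, so the two steps that lower this coordinate contribute a factor \<open>X\<close>.
\<close>

lemma delannoy_diag_rec:
  "delannoy_diag (Suc (Suc k))
     = (1 + fps_X) * delannoy_diag (Suc k) + fps_X * delannoy_diag k"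
proof (rule fps_ext)
  fix n
  show "delannoy_diag (Suc (Suc k)) $ n
     = ((1 + fps_X) * delannoy_diag (Suc k) + fps_X * delannoy_diag k) $ n"
  proof (cases n)
    case 0
    then show ?thesis by (simp add: distrib_right delannoy_diag_nth delannoy_0_right)
  next
    case (Suc i)
    \<comment> \<open>The coefficient of \<open>X ^ Suc (Suc k)\<close> sits on the boundary of the Delannoy table.\<close>
    consider "i \<le> k" | "i = Suc k" | "i > Suc k" by linarith
    then show ?thesis
    proof cases
      case 1
      then have "Suc k - i = Suc (k - i)" by simp
      then show ?thesis
        using 1 Suc by (simp add: distrib_right delannoy_diag_nth delannoy_Suc_Suc)
    qed (use Suc in \<open>simp_all add: distrib_right delannoy_diag_nth delannoy_0_left\<close>)
  qed
qed

section \<open>Power series of the powers of the length\<close>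

text \<open>
  \<open>moment j\<close> is \<open>\<Sum>l\<ge>1. l ^ j * X ^ l\<close>. The case distinction matters for \<open>j = 0\<close> only: the
  length \<open>0\<close> must be excluded there although \<open>0 ^ 0 = 1\<close>.
\<close>

definition moment :: "nat \<Rightarrow> rat fps" where
  "moment j = Abs_fps (\<lambda>l. if l = 0 then 0 else of_nat l ^ j)"

abbreviation (input) geo :: "rat fps" where "geo \<equiv> inverse (1 - fps_X)"

lemma one_minus_X_inverse: "(1 - fps_X) * (inverse (1 - fps_X) :: rat fps) = 1"
  by (rule inverse_mult_eq_1') simp

text \<open>
  Multiplication by \<open>1 - X\<close> takes differences of consecutive coefficients. The constant sequence
  telescopes to \<open>X\<close>; as \<open>l - (l - 1) = 1\<close> and \<open>l\<^sup>2 - (l - 1)\<^sup>2 = 2 * l - 1\<close>, the next two moments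
  reduce to lower ones.
\<close>

lemma moment_0: "moment 0 = fps_X * geo"
proof -
  have "(1 - fps_X) * moment 0 = fps_X"
    by (rule fps_ext) (auto simp: moment_def left_diff_distrib fps_X_nth)
  then show ?thesis using one_minus_X_inverse
    by (metis mult.assoc mult.commute mult_1_right)
qed

lemma moment_1: "moment 1 = fps_X * geo ^ 2"
proof -
  have "(1 - fps_X) * moment 1 = moment 0"
    by (rule fps_ext) (auto simp: moment_def left_diff_distrib of_nat_diff)
  then have "moment 1 = moment 0 * geo" using one_minus_X_inverse
    by (metis mult.assoc mult.commute mult_1_right)
  then show ?thesis by (simp add: moment_0 power2_eq_square mult.assoc)
qed

lemma moment_2: "moment 2 = fps_X * (1 + fps_X) * geo ^ 3"
proof -
  have "(1 - fps_X) * moment 2 = 2 * moment 1 - moment 0"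
  proof (rule fps_ext)
    fix n
    show "((1 - fps_X) * moment 2) $ n = (2 * moment 1 - moment 0) $ n"
      by (cases n) (auto simp: moment_def left_diff_distrib numeral_fps_const power2_eq_square algebra_simps)
  qed
  then have "moment 2 = (2 * moment 1 - moment 0) * geo" using one_minus_X_inverse
    by (metis mult.assoc mult.commute mult_1_right)
  also have "\<dots> = (2 - (1 - fps_X)) * fps_X * geo ^ 3"
    using one_minus_X_inverse unfolding moment_0 moment_1 by algebra
  finally show ?thesis by (simp add: mult.commute)
qed

section \<open>The linear recurrence for interval chains\<close>

text \<open>
  For an interval \<open>I\<close> of length \<open>l\<close>, let \<open>F k l\<close> be the generating function, by total length, of
  the lists of \<open>k\<close> intervals that can follow \<open>I\<close> in a chain. An interval of length \<open>l'\<close> can be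
  placed next to \<open>I\<close> in \<open>l + l' - 1\<close> ways, whence
  \<open>F (Suc k) l = (\<Sum>l'\<ge>1. (l + l' - 1) * X ^ l' * F k l')\<close>. By induction \<open>F k l\<close> is an affine
  function \<open>l * U + V\<close> of \<open>l\<close>, and the recurrence becomes linear in the pair \<open>(U, V)\<close>, with
  moments as coefficients. Its components are the slope and the offset.
\<close>

fun affine_gf :: "nat \<Rightarrow> rat fps \<times> rat fps" where
  "affine_gf 0 = (0, 1)"
| "affine_gf (Suc k) = (case affine_gf k of (U, V) \<Rightarrow>
     (moment 1 * U + moment 0 * V, (moment 2 - moment 1) * U + (moment 1 - moment 0) * V))"

definition slope_gf :: "nat \<Rightarrow> rat fps" where
  "slope_gf k = fst (affine_gf k)"
definition offset_gf :: "nat \<Rightarrow> rat fps" where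
  "offset_gf k = snd (affine_gf k)"

lemma slope_offset_simps:
  "slope_gf 0 = 0" "offset_gf 0 = 1"
  "slope_gf (Suc k) = moment 1 * slope_gf k + moment 0 * offset_gf k"
  "offset_gf (Suc k) = (moment 2 - moment 1) * slope_gf k + (moment 1 - moment 0) * offset_gf k"
  by (simp_all add: slope_gf_def offset_gf_def split: prod.splits)

text \<open>
  The Cayley--Hamilton relation of the \<open>2 \<times> 2\<close> matrix of the recurrence: the trace is
  \<open>X * (1 + X) / (1 - X)\<^sup>2\<close> and the determinant is \<open>- X ^ 3 / (1 - X) ^ 4\<close>.
\<close>

lemma slope_gf_rec:
  "slope_gf (Suc (Suc k)) = fps_X * (1 + fps_X) * geo ^ 2 * slope_gf (Suc k)
     + fps_X ^ 3 * geo ^ 4 * slope_gf k"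
  using one_minus_X_inverse unfolding slope_offset_simps moment_0 moment_1 moment_2 by algebra

lemma C_gf_eq: "C_gf k = fps_X ^ (k + 1) * geo ^ (2 * k + 1) * delannoy_diag k"
  unfolding C_gf_def delannoy_diag_def by (subst fps_divide_unit) (simp_all add: fps_inverse_power del: power_Suc)

text \<open>
  After the factor \<open>X ^ (k + 1) / (1 - X) ^ (2 * k + 1)\<close> is taken out, the recurrence for
  \<open>slope_gf\<close> is the recurrence for the Delannoy antidiagonals.
\<close>

lemma C_gf_eq_slope_gf: "C_gf k = slope_gf (Suc k)"
proof (induction k rule: induct_nat_012)
  case 0
  then show ?case
    by (simp add: C_gf_eq slope_offset_simps moment_0 delannoy_diag_def delannoy_0_left)
next
  case 1
  have "delannoy_diag (Suc 0) = 1 + fps_X"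
    by (simp add: delannoy_diag_def delannoy_0_left delannoy_0_right)
  then show ?case using one_minus_X_inverse
    unfolding C_gf_eq slope_offset_simps moment_0 moment_1 moment_2 by simp algebra
next
  case (ge2 k)
  show ?case
    unfolding slope_gf_rec[of "Suc k"] ge2[symmetric] C_gf_eq delannoy_diag_rec
    by (simp add: algebra_simps power_add power2_eq_square eval_nat_numeral)
qed

section \<open>Counting interval chains\<close>

text \<open>
  The pair \<open>(a, l)\<close> stands for the \<open>l\<close> consecutive unit cells of the integer line beginning at
  \<open>a\<close>. Keeping the length as a natural number makes it directly usable as an exponent.
\<close>

type_synonym interval = "int \<times> nat"

definition cells :: "interval \<Rightarrow> int set" where
  "cells I = {fst I..<fst I + int (snd I)}"

definition meet :: "interval \<Rightarrow> interval \<Rightarrow> bool" where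
  "meet I J \<longleftrightarrow> cells I \<inter> cells J \<noteq> {}"

definition interval_chain :: "interval list \<Rightarrow> bool" where
  "interval_chain Is \<longleftrightarrow> (\<forall>I\<in>set Is. snd I > 0) \<and> successively meet Is"

abbreviation total_length :: "interval list \<Rightarrow> nat" where
  "total_length Is \<equiv> sum_list (map snd Is)"

lemma meet_iff:
  assumes "snd I > 0" "snd J > 0"
  shows "meet I J \<longleftrightarrow> fst I < fst J + int (snd J) \<and> fst J < fst I + int (snd I)"
proof
  assume "meet I J"
  then obtain t where "t \<in> cells I" "t \<in> cells J" by (auto simp: meet_def)
  then show "fst I < fst J + int (snd J) \<and> fst J < fst I + int (snd I)"
    by (auto simp: cells_def)
next
  assume "fst I < fst J + int (snd J) \<and> fst J < fst I + int (snd I)"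
  then have "max (fst I) (fst J) \<in> cells I \<inter> cells J"
    using assms by (auto simp: cells_def)
  then show "meet I J" by (auto simp: meet_def)
qed

definition continuations :: "interval \<Rightarrow> nat \<Rightarrow> nat \<Rightarrow> interval list set" where
  "continuations I k n =
     {Is. length Is = k \<and> interval_chain (I # Is) \<and> total_length Is = n}"

lemma Cons_in_image_Cons: "x # xs \<in> Cons y ` S \<longleftrightarrow> x = y \<and> xs \<in> S"
  by auto

lemma continuations_0: "snd I > 0 \<Longrightarrow> continuations I 0 n = (if n = 0 then {[]} else {})"
  by (auto simp: continuations_def interval_chain_def)

text \<open>
  A following interval of length \<open>l\<close> meets \<open>I\<close> exactly if its first cell lies strictly between
  \<open>fst I - l\<close> and \<open>fst I + snd I\<close>. The index pairs carry the length first because the range of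
  first cells depends on it.
\<close>

lemma continuations_Suc:
  assumes "snd I > 0"
  shows "continuations I (Suc k) n =
    (\<Union>J \<in> (SIGMA l:{1..n}. {fst I - int l<..<fst I + int (snd I)}).
       Cons (snd J, fst J) ` continuations (snd J, fst J) k (n - fst J))"
proof (rule set_eqI)
  fix Is
  show "Is \<in> continuations I (Suc k) n \<longleftrightarrow> Is \<in>
    (\<Union>J \<in> (SIGMA l:{1..n}. {fst I - int l<..<fst I + int (snd I)}).
       Cons (snd J, fst J) ` continuations (snd J, fst J) k (n - fst J))"
  proof (cases Is)
    case (Cons J Js)
    have "Is \<in> continuations I (Suc k) n \<longleftrightarrow>
        snd J > 0 \<and> meet I J \<and> snd J \<le> n \<and> Js \<in> continuations J k (n - snd J)"
      using assms by (auto simp: Cons continuations_def interval_chain_def)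
    also have "\<dots> \<longleftrightarrow> 1 \<le> snd J \<and> snd J \<le> n \<and>
        fst J \<in> {fst I - int (snd J)<..<fst I + int (snd I)} \<and> Js \<in> continuations J k (n - snd J)"
      using assms by (auto simp: meet_iff)
    also have "\<dots> \<longleftrightarrow> (\<exists>K \<in> (SIGMA l:{1..n}. {fst I - int l<..<fst I + int (snd I)}).
        J = (snd K, fst K) \<and> Js \<in> continuations (snd K, fst K) k (n - fst K))"
      by (cases J) auto
    finally show ?thesis
      by (simp add: Cons Cons_in_image_Cons)
  qed (auto simp: continuations_def)
qed

text \<open>
  The induction step evaluates \<open>\<Sum>l\<ge>1. (l - 1 + snd I) * (l * slope_gf k + offset_gf k) * X ^ l\<close>:
  the terms are grouped by powers of \<open>l\<close>, which produces the moments, and by powers of \<open>snd I\<close>, which yields the new slope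
  and offset.
\<close>

lemma finite_card_continuations:
  assumes "snd I > 0"
  shows "finite (continuations I k n) \<and>
    (of_nat (card (continuations I k n)) :: rat) = (of_nat (snd I) * slope_gf k + offset_gf k) $ n"
  using assms
proof (induction k arbitrary: I n)
  case 0
  then show ?case by (simp add: continuations_0 slope_offset_simps)
next
  case (Suc k)
  define S where "S = (SIGMA l:{1..n}. {fst I - int l<..<fst I + int (snd I)})"
  define F where
    "F = (\<lambda>J :: nat \<times> int. Cons (snd J, fst J) ` continuations (snd J, fst J) k (n - fst J))"
  have eq: "continuations I (Suc k) n = (\<Union>J\<in>S. F J)"
    unfolding S_def F_def by (rule continuations_Suc) fact
  have S: "finite S" by (auto simp: S_def)
  have F: "finite (F J)" if "J \<in> S" for J
    using that Suc.IH by (auto simp: S_def F_def)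
  have card_F: "(of_nat (card (F (l, a))) :: rat) = of_nat l * slope_gf k $ (n - l) + offset_gf k $ (n - l)"
    if "l \<ge> 1" for l a
    using that Suc.IH[of "(a, l)" "n - l"] by (simp add: F_def card_image fps_of_nat [symmetric])
  have "card (\<Union>J\<in>S. F J) = (\<Sum>J\<in>S. card (F J))"
    using S F by (intro card_UN_disjoint) (auto simp: F_def)
  then have "(of_nat (card (\<Union>J\<in>S. F J)) :: rat) = (\<Sum>J\<in>S. of_nat (card (F J)))"
    by simp
  also have "\<dots> = (\<Sum>l\<in>{1..n}. \<Sum>a\<in>{fst I - int l<..<fst I + int (snd I)}. of_nat (card (F (l, a))))"
    unfolding S_def by (subst sum.Sigma) auto
  also have "\<dots> = (\<Sum>l\<in>{1..n}. (of_nat l - 1 + of_nat (snd I)) * (of_nat l * slope_gf k $ (n - l) + offset_gf k $ (n - l)))"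
  proof (rule sum.cong)
    fix l assume "l \<in> {1..n}"
    then have "l \<ge> 1" by simp
    then show "(\<Sum>a\<in>{fst I - int l<..<fst I + int (snd I)}. of_nat (card (F (l, a))))
        = (of_nat l - 1 + of_nat (snd I)) * (of_nat l * slope_gf k $ (n - l) + offset_gf k $ (n - l))"
      by (simp add: card_F of_nat_diff)
  qed simp
  \<comment> \<open>All moments vanish at \<open>0\<close>, so the sum may start there and becomes a convolution.\<close>
  also have "\<dots> = (\<Sum>l = 0..n. (moment 2 $ l - moment 1 $ l + of_nat (snd I) * moment 1 $ l) * slope_gf k $ (n - l)
      + (moment 1 $ l - moment 0 $ l + of_nat (snd I) * moment 0 $ l) * offset_gf k $ (n - l))"
    by (rule sum.mono_neutral_cong_left)
       (auto simp: moment_def power2_eq_square algebra_simps)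
  also have "\<dots> = ((moment 2 - moment 1 + of_nat (snd I) * moment 1) * slope_gf k
      + (moment 1 - moment 0 + of_nat (snd I) * moment 0) * offset_gf k) $ n"
    by (simp add: fps_mult_nth [of "_ + _"] sum.distrib fps_of_nat [symmetric])
  also have "\<dots> = (of_nat (snd I) * slope_gf (Suc k) + offset_gf (Suc k)) $ n"
    by (simp add: slope_offset_simps algebra_simps)
  finally show ?case using S F by (auto simp: eq)
qed

text \<open>
  A chain whose first interval begins at \<open>0\<close> is the normal form of its translates.
\<close>

definition normal_chains :: "nat \<Rightarrow> nat \<Rightarrow> interval list set" where
  "normal_chains k n = {Is. length Is = k \<and> interval_chain Is \<and> fst (hd Is) = 0 \<and> total_length Is = n}"

text \<open>
  Summing \<open>(l * slope_gf k + offset_gf k) * X ^ l\<close> over the length \<open>l \<ge> 1\<close> of the first interval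
  gives \<open>slope_gf (Suc k)\<close> once more, by its recurrence.
\<close>

lemma finite_card_normal_chains:
  shows "finite (normal_chains (Suc k) n)"
    and "(of_nat (card (normal_chains (Suc k) n)) :: rat) = C_gf k $ n"
proof -
  define F where "F = (\<lambda>l. Cons (0, l) ` continuations (0, l) k (n - l))"
  have eq: "normal_chains (Suc k) n = (\<Union>l\<in>{1..n}. F l)"
  proof (rule set_eqI)
    fix Is
    show "Is \<in> normal_chains (Suc k) n \<longleftrightarrow> Is \<in> (\<Union>l\<in>{1..n}. F l)"
    proof (cases Is)
      case (Cons I Js)
      then show ?thesis
        by (cases I) (auto simp: normal_chains_def F_def continuations_def interval_chain_def
          Cons_in_image_Cons)
    qed (auto simp: normal_chains_def F_def)
  qed
  have F: "finite (F l)" if "l \<in> {1..n}" for l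
    using that finite_card_continuations[of "(0, l)"] by (auto simp: F_def)
  show "finite (normal_chains (Suc k) n)" using F by (auto simp: eq)
  have "card (\<Union>l\<in>{1..n}. F l) = (\<Sum>l\<in>{1..n}. card (F l))"
    using F by (intro card_UN_disjoint) (auto simp: F_def)
  then have "(of_nat (card (normal_chains (Suc k) n)) :: rat) = (\<Sum>l\<in>{1..n}. of_nat (card (F l)))"
    by (simp add: eq)
  also have "\<dots> = (\<Sum>l\<in>{1..n}. of_nat l * slope_gf k $ (n - l) + offset_gf k $ (n - l))"
    using finite_card_continuations
    by (intro sum.cong) (simp_all add: F_def card_image fps_of_nat [symmetric])
  also have "\<dots> = (\<Sum>l = 0..n. moment 1 $ l * slope_gf k $ (n - l) + moment 0 $ l * offset_gf k $ (n - l))"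
    by (rule sum.mono_neutral_cong_left) (auto simp: moment_def)
  also have "\<dots> = slope_gf (Suc k) $ n"
    by (simp add: slope_offset_simps fps_mult_nth sum.distrib)
  finally show "(of_nat (card (normal_chains (Suc k) n)) :: rat) = C_gf k $ n"
    by (simp add: C_gf_eq_slope_gf)
qed

section \<open>Solids built from two interval chains\<close>

text \<open>
  A stack of rectangular layers whose sides are the entries of the two lists. The bounds on \<open>x\<close>
  keep the layer index \<open>nat (x - x0)\<close> within the first list; the lists are meant to be equally long.
\<close>

definition solid :: "int \<Rightarrow> interval list \<Rightarrow> interval list \<Rightarrow> cell set" where
  "solid x0 Is Js = {(x, y, z). x0 \<le> x \<and> x < x0 + int (length Is) \<and>
     y \<in> cells (Is ! nat (x - x0)) \<and> z \<in> cells (Js ! nat (x - x0))}"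

abbreviation chain_pair :: "nat \<Rightarrow> interval list \<Rightarrow> interval list \<Rightarrow> bool" where
  "chain_pair k Is Js \<equiv>
     length Is = k \<and> length Js = k \<and> interval_chain Is \<and> interval_chain Js"

lemma successively_nth: "successively P xs \<longleftrightarrow> (\<forall>i. Suc i < length xs \<longrightarrow> P (xs ! i) (xs ! Suc i))"
proof (induction P xs rule: successively.induct)
  case (3 P x y xs)
  then show ?case by (auto simp: nth_Cons less_Suc_eq_0_disj split: nat.splits)
qed auto

lemma interval_chain_meet:
  "interval_chain Is \<Longrightarrow> Suc i < length Is \<Longrightarrow> cells (Is ! i) \<inter> cells (Is ! Suc i) \<noteq> {}"
  by (auto simp: interval_chain_def successively_nth meet_def)

lemma cells_nonempty_iff: "cells I \<noteq> {} \<longleftrightarrow> snd I > 0"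
  by (auto simp: cells_def)

lemma cells_inject: "snd I > 0 \<Longrightarrow> snd J > 0 \<Longrightarrow> cells I = cells J \<longleftrightarrow> I = J"
  by (auto simp: cells_def prod_eq_iff atLeastLessThan_eq_iff)

lemma interval_chain_nth_pos: "interval_chain Is \<Longrightarrow> i < length Is \<Longrightarrow> snd (Is ! i) > 0"
  by (auto simp: interval_chain_def)

lemma finite_cells [simp]: "finite (cells I)" and card_cells [simp]: "card (cells I) = snd I"
  by (simp_all add: cells_def)

lemma layer_solid:
  "i < length Is \<Longrightarrow> solid x0 Is Js \<inter> {x0 + int i} \<times> UNIV = {x0 + int i} \<times> cells (Is ! i) \<times> cells (Js ! i)"
  by (auto simp: solid_def)

lemma solid_eq_UN:
  "solid x0 Is Js = (\<Union>i<length Is. {x0 + int i} \<times> cells (Is ! i) \<times> cells (Js ! i))" (is "_ = ?R")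
proof
  show "solid x0 Is Js \<subseteq> ?R"
  proof
    fix c assume c: "c \<in> solid x0 Is Js"
    obtain x y z where [simp]: "c = (x, y, z)" by (cases c)
    have "nat (x - x0) < length Is" "x = x0 + int (nat (x - x0))"
      using c by (auto simp: solid_def)
    then show "c \<in> ?R" using c by (auto simp: solid_def intro!: bexI[of _ "nat (x - x0)"])
  qed
qed (auto simp: solid_def)

lemma fst_solid:
  assumes "chain_pair k Is Js"
  shows "fst ` solid x0 Is Js = {x0..<x0 + int k}"
proof
  show "{x0..<x0 + int k} \<subseteq> fst ` solid x0 Is Js"
  proof
    fix x assume x: "x \<in> {x0..<x0 + int k}"
    then have "nat (x - x0) < k" by auto
    then have "cells (Is ! nat (x - x0)) \<noteq> {}" "cells (Js ! nat (x - x0)) \<noteq> {}"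
      using assms by (simp_all add: cells_nonempty_iff interval_chain_nth_pos)
    then show "x \<in> fst ` solid x0 Is Js"
      using x assms by (force simp: solid_def)
  qed
qed (use assms in \<open>auto simp: solid_def\<close>)

section \<open>Solids are plateau polycubes\<close>

abbreviation linked :: "cell set \<Rightarrow> cell rel" where
  "linked P \<equiv> {(c, d). c \<in> P \<and> d \<in> P \<and> face_adjacent c d}\<^sup>*"

lemma face_adjacent_sym: "face_adjacent c d \<longleftrightarrow> face_adjacent d c"
  by (cases c; cases d) (auto simp: abs_minus_commute)

lemma linked_sym: "(c, d) \<in> linked P \<Longrightarrow> (d, c) \<in> linked P"
proof -
  have "sym {(c, d). c \<in> P \<and> d \<in> P \<and> face_adjacent c d}"
    by (auto simp: sym_def face_adjacent_sym)
  then show "(c, d) \<in> linked P \<Longrightarrow> (d, c) \<in> linked P" by (meson sym_rtrancl symD)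
qed

text \<open>
  The line is given by a parametrisation so that one statement serves both directions orthogonal
  to the first axis.
\<close>

lemma linked_line:
  fixes f :: "int \<Rightarrow> cell"
  assumes "\<And>t. t \<in> {a..<b} \<Longrightarrow> f t \<in> P" and "\<And>t. face_adjacent (f t) (f (t + 1))"
    and "s \<in> {a..<b}" "t \<in> {a..<b}"
  shows "(f s, f t) \<in> linked P"
proof -
  have up: "s \<in> {a..<b} \<Longrightarrow> t < b \<Longrightarrow> (f s, f t) \<in> linked P" if "s \<le> t" for s t :: int
    using that
  proof (induction t rule: int_ge_induct)
    case (step t)
    then have "(f t, f (t + 1)) \<in> linked P"
      using assms(1,2) by (intro r_into_rtrancl) auto
    then show ?case using step by (meson less_trans zless_add1_eq rtrancl_trans)
  qed simp
  show ?thesis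
    using up[of s t] up[of t s] assms(3,4) linked_sym by (cases "s \<le> t") auto
qed

lemma linked_box:
  assumes "{x} \<times> cells I \<times> cells J \<subseteq> P" "y \<in> cells I" "y' \<in> cells I" "z \<in> cells J" "z' \<in> cells J"
  shows "((x, y, z), (x, y', z')) \<in> linked P"
proof (rule rtrancl_trans)
  show "((x, y, z), (x, y', z)) \<in> linked P"
    using assms by (intro linked_line[where f = "\<lambda>t. (x, t, z)"]) (auto simp: cells_def)
  show "((x, y', z), (x, y', z')) \<in> linked P"
    using assms by (intro linked_line[where f = "\<lambda>t. (x, y', t)"]) (auto simp: cells_def)
qed

text \<open>
  Every cell is linked to a fixed cell of the first plateau: two consecutive plateaus share a
  face because their projections to the second and to the third axis both meet.
\<close>

lemma polycube_solid:
  assumes "chain_pair k Is Js" "k > 0"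
  shows "polycube (solid x0 Is Js)"
  unfolding polycube_def
proof (intro conjI)
  let ?P = "solid x0 Is Js"
  show "finite ?P" by (simp add: solid_eq_UN)
  have "fst ` ?P \<noteq> {}" using assms by (simp add: fst_solid)
  then show "?P \<noteq> {}" by blast
  obtain y0 z0 where y0: "y0 \<in> cells (Is ! 0)" and z0: "z0 \<in> cells (Js ! 0)"
    using assms cells_nonempty_iff[of "Is ! 0"] cells_nonempty_iff[of "Js ! 0"]
    by (auto simp: interval_chain_nth_pos)
  have box: "{x0 + int i} \<times> cells (Is ! i) \<times> cells (Js ! i) \<subseteq> ?P" if "i < k" for i
    using that assms by (auto simp: solid_eq_UN)
  have base: "((x0, y0, z0), (x0 + int i, y, z)) \<in> linked ?P"
    if "i < k" "y \<in> cells (Is ! i)" "z \<in> cells (Js ! i)" for i y z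
    using that
  proof (induction i arbitrary: y z)
    case 0
    then show ?case using linked_box[of x0 "Is ! 0" "Js ! 0"] box[of 0] y0 z0 by simp
  next
    case (Suc i)
    obtain u where u: "u \<in> cells (Is ! i)" "u \<in> cells (Is ! Suc i)"
      using interval_chain_meet[of Is i] Suc.prems assms by auto
    obtain v where v: "v \<in> cells (Js ! i)" "v \<in> cells (Js ! Suc i)"
      using interval_chain_meet[of Js i] Suc.prems assms by auto
    have "((x0, y0, z0), (x0 + int i, u, v)) \<in> linked ?P"
      using Suc u v by auto
    also have "((x0 + int i, u, v), (x0 + int (Suc i), u, v)) \<in> linked ?P"
      using box[of i] box[of "Suc i"] Suc.prems u v by (intro r_into_rtrancl) auto
    also have "((x0 + int (Suc i), u, v), (x0 + int (Suc i), y, z)) \<in> linked ?P"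
      using box[of "Suc i"] Suc.prems u v by (intro linked_box)
    finally show ?case .
  qed
  have base': "((x0, y0, z0), c) \<in> linked ?P" if "c \<in> ?P" for c
    using that base assms by (auto simp: solid_eq_UN)
  show "face_connected ?P"
    unfolding face_connected_def
  proof (intro ballI)
    fix c d assume "c \<in> ?P" "d \<in> ?P"
    then show "(c, d) \<in> linked ?P"
      by (blast intro: rtrancl_trans [OF linked_sym [OF base'] base'])
  qed
qed

lemma width_eq:
  assumes "fst ` P = {x0..<x0 + int k}" "k > 0"
  shows "width P = int k"
proof -
  have "(\<lambda>(x, y, z). x + 1) ` P = (\<lambda>x. x + 1) ` fst ` P" "(\<lambda>(x, y, z). x) ` P = fst ` P"
    by (force simp: image_image)+
  moreover have "Max ((\<lambda>x. x + 1) ` {x0..<x0 + int k}) = x0 + int k"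
    using assms(2) by (intro Max_eqI) (auto intro: image_eqI[of _ _ "x0 + int k - 1"])
  moreover have "Min {x0..<x0 + int k} = x0"
    using assms(2) by (intro Min_eqI) auto
  ultimately show ?thesis unfolding width_def assms(1) by simp
qed

lemma cells_closed: "\<exists>a b. cells I = {a..b}"
  by (rule exI[of _ "fst I"], rule exI[of _ "fst I + int (snd I) - 1"]) (auto simp: cells_def)

lemma plateau_box:
  assumes "snd I > 0" "snd J > 0"
  shows "plateau ({x} \<times> cells I \<times> cells J)"
proof -
  have eq: "{x} \<times> cells I \<times> cells J = solid x [I] [J]"
    by (auto simp: solid_eq_UN)
  have pair: "chain_pair 1 [I] [J]" using assms by (auto simp: interval_chain_def)
  have "stratum ({x} \<times> cells I \<times> cells J)"
    unfolding stratum_def eq using polycube_solid[OF pair] width_eq[OF fst_solid[OF pair]] by simp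
  then show ?thesis
    unfolding plateau_def using cells_closed[of I] cells_closed[of J] by metis
qed

lemma plateau_polycube_solid:
  assumes "chain_pair k Is Js" "k > 0"
  shows "plateau_polycube (solid x0 Is Js)"
proof -
  have "plateau S" if "S \<in> strata (solid x0 Is Js)" for S
  proof -
    from that obtain x where x: "x \<in> {x0..<x0 + int k}" and S: "S = solid x0 Is Js \<inter> {x} \<times> UNIV"
      unfolding strata_def fst_solid[OF assms(1)] by blast
    define i where "i = nat (x - x0)"
    have "i < k" "x = x0 + int i" using x by (auto simp: i_def)
    then show "plateau S"
      using assms by (simp add: S layer_solid plateau_box interval_chain_nth_pos)
  qed
  then show ?thesis using polycube_solid[OF assms] by (simp add: plateau_polycube_def)
qed

text \<open>
  Every entry of a chain is nonempty, so a projection forgets one of the two lists and turns each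
  plateau into the interval given by the other one.
\<close>

lemma lateral_area_solid:
  assumes "chain_pair k Is Js"
  shows "lateral_area (solid x0 Is Js) = total_length Is + total_length Js"
proof -
  have ne: "cells (Is ! i) \<noteq> {}" "cells (Js ! i) \<noteq> {}" if "i < k" for i
    using that assms by (simp_all add: cells_nonempty_iff interval_chain_nth_pos)
  have box: "B \<noteq> {} \<Longrightarrow> (\<lambda>(x, y, z). (x, y)) ` ({x} \<times> A \<times> B) = {x} \<times> A"
    "A \<noteq> {} \<Longrightarrow> (\<lambda>(x, y, z). (x, z)) ` ({x} \<times> A \<times> B) = {x} \<times> B"
    for x :: int and A B :: "int set"
    by force+
  have xy: "(\<lambda>(x, y, z). (x, y)) ` solid x0 Is Js = (\<Union>i<k. {x0 + int i} \<times> cells (Is ! i))"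
    using assms ne by (simp add: solid_eq_UN image_UN box)
  have xz: "(\<lambda>(x, y, z). (x, z)) ` solid x0 Is Js = (\<Union>i<k. {x0 + int i} \<times> cells (Js ! i))"
    using assms ne by (simp add: solid_eq_UN image_UN box)
  have "card (\<Union>i<k. {x0 + int i} \<times> cells (Ks ! i)) = total_length Ks" if "length Ks = k" for Ks
    using that by (subst card_UN_disjoint) (auto simp: sum_list_sum_nth atLeast0LessThan card_cartesian_product)
  then show ?thesis using assms by (simp add: lateral_area_def xy xz)
qed

section \<open>Plateau polycubes are solids\<close>

text \<open>
  A path of face-adjacent cells changes its first coordinate by at most one per step, and a step
  that changes it keeps the other two coordinates.
\<close>

lemma crossing:
  assumes "face_connected P" "c \<in> P" "d \<in> P" "fst c \<le> x" "x < fst d"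
  obtains y z where "(x, y, z) \<in> P" "(x + 1, y, z) \<in> P"
proof -
  have "(c, d) \<in> linked P" using assms by (simp add: face_connected_def)
  then have "x < fst d \<longrightarrow> (\<exists>y z. (x, y, z) \<in> P \<and> (x + 1, y, z) \<in> P)"
  proof (induction rule: rtrancl_induct)
    case base
    then show ?case using assms(4) by simp
  next
    case (step e f)
    obtain x1 y1 z1 where e: "e = (x1, y1, z1)" by (cases e)
    obtain x2 y2 z2 where f: "f = (x2, y2, z2)" by (cases f)
    have adj: "\<bar>x1 - x2\<bar> + \<bar>y1 - y2\<bar> + \<bar>z1 - z2\<bar> = 1" and P: "e \<in> P" "f \<in> P"
      using step by (auto simp: e f)
    show ?case
    proof (cases "x < x1 \<or> \<not> x < x2")
      case False
      then have "x1 = x" "x2 = x + 1" "y1 = y2" "z1 = z2" using adj by linarith+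
      then show ?thesis using P by (auto simp: e f)
    qed (use step e f in auto)
  qed
  then show thesis using assms(5) that by blast
qed

lemma plateau_imp_box:
  assumes "plateau S" "S \<subseteq> {x} \<times> UNIV"
  shows "\<exists>I J. snd I > 0 \<and> snd J > 0 \<and> S = {x} \<times> cells I \<times> cells J"
proof -
  from assms(1) have "S \<noteq> {}" by (simp add: plateau_def stratum_def polycube_def)
  moreover from assms(1) obtain x' a b c d where S: "S = {x'} \<times> {a..b} \<times> {c..d}"
    unfolding plateau_def by blast
  ultimately have le: "a \<le> b" "c \<le> d" by auto
  then have "(x', a, c) \<in> S" by (simp add: S)
  then have x: "x' = x" using assms(2) by auto
  have "{a..b} = cells (a, nat (b - a + 1))" "{c..d} = cells (c, nat (d - c + 1))"
    using le by (auto simp: cells_def)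
  then have "S = {x} \<times> cells (a, nat (b - a + 1)) \<times> cells (c, nat (d - c + 1))"
    by (simp add: S x)
  then show ?thesis using le by (intro exI conjI) auto
qed

text \<open>
  Connectedness is used through \<open>crossing\<close> only. It shows that no layer between the first and
  the last one is empty, and it provides a common cell in the projections of two consecutive
  plateaus, so that both lists of intervals are chains.
\<close>

lemma plateau_polycube_imp_solid:
  assumes "plateau_polycube P" "width P = int k"
  obtains x0 Is Js where "chain_pair k Is Js" "P = solid x0 Is Js"
proof -
  have fin: "finite P" and ne: "P \<noteq> {}" and conn: "face_connected P"
    and strat: "\<And>x. x \<in> fst ` P \<Longrightarrow> plateau (P \<inter> {x} \<times> UNIV)"
    using assms(1) by (auto simp: plateau_polycube_def polycube_def strata_def)
  define x0 where "x0 = Min (fst ` P)"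
  define x1 where "x1 = Max (fst ` P)"
  have x0: "x0 \<in> fst ` P" and x1: "x1 \<in> fst ` P"
    using fin ne by (simp_all add: x0_def x1_def)
  have bounds: "x0 \<le> x" "x \<le> x1" if "x \<in> fst ` P" for x
    using that fin by (simp_all add: x0_def x1_def)
  have cross: "\<exists>y z. (x, y, z) \<in> P \<and> (x + 1, y, z) \<in> P" if "x0 \<le> x" "x < x1" for x
  proof -
    from x0 x1 obtain c d where "c \<in> P" "x0 = fst c" "d \<in> P" "x1 = fst d" by blast
    then show ?thesis using that crossing[OF conn, of c d x] by blast
  qed
  have range: "fst ` P = {x0..<x0 + int (nat (x1 + 1 - x0))}"
  proof
    show "fst ` P \<subseteq> {x0..<x0 + int (nat (x1 + 1 - x0))}" using bounds by force
    show "{x0..<x0 + int (nat (x1 + 1 - x0))} \<subseteq> fst ` P"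
    proof
      fix x assume "x \<in> {x0..<x0 + int (nat (x1 + 1 - x0))}"
      then have "x0 \<le> x" "x < x1 \<or> x = x1" by (auto split: if_splits)
      then show "x \<in> fst ` P"
        using cross[of x] x1 by (elim disjE) force+
    qed
  qed
  have "nat (x1 + 1 - x0) > 0" using bounds[OF x0] by simp
  from width_eq[OF range this] have k: "nat (x1 + 1 - x0) = k"
    unfolding assms(2) of_nat_eq_iff by simp
  have "\<forall>x. \<exists>I J. x \<in> fst ` P \<longrightarrow>
      snd I > 0 \<and> snd J > 0 \<and> P \<inter> {x} \<times> UNIV = {x} \<times> cells I \<times> cells J"
    using plateau_imp_box[OF strat inf_le2] by blast
  then obtain I J where IJ: "\<And>x. x \<in> fst ` P \<Longrightarrow> snd (I x) > 0 \<and> snd (J x) > 0 \<and>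
      P \<inter> {x} \<times> UNIV = {x} \<times> cells (I x) \<times> cells (J x)"
    unfolding choice_iff by blast
  define Is where "Is = map (\<lambda>i. I (x0 + int i)) [0..<k]"
  define Js where "Js = map (\<lambda>i. J (x0 + int i)) [0..<k]"
  have layer: "x0 + int i \<in> fst ` P" if "i < k" for i using that range k by simp
  have "interval_chain Is \<and> interval_chain Js"
  proof -
    have "meet (I (x0 + int i)) (I (x0 + int (Suc i))) \<and> meet (J (x0 + int i)) (J (x0 + int (Suc i)))"
      if "Suc i < k" for i
    proof -
      have "x0 \<le> x0 + int i" "x0 + int i < x1" using that k by simp_all
      from cross[OF this]
      obtain y z where "(x0 + int i, y, z) \<in> P" "(x0 + int (Suc i), y, z) \<in> P"
        by (auto simp: ac_simps)
      then have "(x0 + int i, y, z) \<in> P \<inter> {x0 + int i} \<times> UNIV"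
        "(x0 + int (Suc i), y, z) \<in> P \<inter> {x0 + int (Suc i)} \<times> UNIV" by auto
      moreover have "i < k" using that by simp
      ultimately have "y \<in> cells (I (x0 + int i))" "z \<in> cells (J (x0 + int i))"
        "y \<in> cells (I (x0 + int (Suc i)))" "z \<in> cells (J (x0 + int (Suc i)))"
        using IJ[OF layer[OF \<open>i < k\<close>]] IJ[OF layer[OF that]] by (simp_all del: of_nat_Suc)
      then show ?thesis unfolding meet_def by blast
    qed
    moreover have "snd (I (x0 + int i)) > 0 \<and> snd (J (x0 + int i)) > 0" if "i < k" for i
      using IJ[OF layer] that by auto
    ultimately show ?thesis
      by (auto simp: interval_chain_def successively_nth Is_def Js_def)
  qed
  then have "chain_pair k Is Js" by (simp add: Is_def Js_def)
  moreover have "P = solid x0 Is Js"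
  proof -
    have fst_P: "fst ` P = (\<lambda>i. x0 + int i) ` {..<k}"
      unfolding range k
    proof
      show "{x0..<x0 + int k} \<subseteq> (\<lambda>i. x0 + int i) ` {..<k}"
        by (auto intro!: image_eqI[of x _ "nat (x - x0)" for x])
    qed auto
    have "P = (\<Union>x\<in>fst ` P. P \<inter> {x} \<times> UNIV)" by force
    also have "\<dots> = (\<Union>i<k. P \<inter> {x0 + int i} \<times> UNIV)" by (simp add: fst_P)
    also have "\<dots>
        = (\<Union>i<k. {x0 + int i} \<times> cells (I (x0 + int i)) \<times> cells (J (x0 + int i)))"
      using IJ layer by simp
    also have "\<dots> = solid x0 Is Js"
      by (simp add: solid_eq_UN Is_def Js_def)
    finally show ?thesis .
  qed
  ultimately show thesis using that by blast
qed

section \<open>Translation classes\<close>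

definition shift :: "int \<Rightarrow> interval list \<Rightarrow> interval list" where
  "shift t = map (\<lambda>I. (t + fst I, snd I))"

lemma cells_shift: "cells (t + a, l) = (+) t ` cells (a, l)"
  by (simp add: cells_def image_add_atLeastLessThan algebra_simps)

lemma interval_chain_shift: "interval_chain (shift t Is) \<longleftrightarrow> interval_chain Is"
proof -
  have "meet (t + fst I, snd I) (t + fst J, snd J) \<longleftrightarrow> meet I J" for I J
    unfolding meet_def cells_shift by auto
  then show ?thesis by (simp add: interval_chain_def shift_def successively_map)
qed

lemma length_shift [simp]: "length (shift t Is) = length Is"
  and total_length_shift: "total_length (shift t Is) = total_length Is"
  by (simp_all add: shift_def comp_def)

lemma hd_shift: "Is \<noteq> [] \<Longrightarrow> fst (hd (shift t Is)) = t + fst (hd Is)"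
  by (simp add: shift_def hd_map)

lemma translate_solid:
  assumes "length Js = length Is"
  shows "(+) (u, v, w) ` solid x0 Is Js = solid (u + x0) (shift v Is) (shift w Js)"
proof -
  have "(+) (u, v, w) ` ({x} \<times> A \<times> B) = {u + x} \<times> (+) v ` A \<times> (+) w ` B" for x A B
    by force
  then show ?thesis
    using assms by (simp add: solid_eq_UN image_UN shift_def cells_shift add.assoc)
qed

lemma solid_inject:
  assumes "chain_pair k Is Js" "chain_pair k' Is' Js'" "k > 0" "k' > 0"
    and eq: "solid x0 Is Js = solid x0' Is' Js'"
  shows "x0 = x0' \<and> Is = Is' \<and> Js = Js'"
proof -
  have "{x0..<x0 + int k} = {x0'..<x0' + int k'}"
    using fst_solid assms by metis
  then have [simp]: "x0' = x0" "k' = k"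
    using assms by (auto simp: atLeastLessThan_eq_iff)
  have "Is ! i = Is' ! i \<and> Js ! i = Js' ! i" if "i < k" for i
  proof -
    have "{x0 + int i} \<times> cells (Is ! i) \<times> cells (Js ! i) = {x0 + int i} \<times> cells (Is' ! i) \<times> cells (Js' ! i)"
      using that eq assms layer_solid[of i Is x0 Js] layer_solid[of i Is' x0 Js'] by simp
    moreover have "snd (Is ! i) > 0" "snd (Js ! i) > 0" "snd (Is' ! i) > 0" "snd (Js' ! i) > 0"
      using that assms by (simp_all add: interval_chain_nth_pos)
    ultimately show ?thesis
      by (auto simp: times_eq_iff cells_inject cells_nonempty_iff [THEN iffD2]
          simp flip: cells_nonempty_iff)
  qed
  then show ?thesis using assms by (auto intro: nth_equalityI)
qed

text \<open>
  Each translation class contains exactly one solid for which both chains are in normal form and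
  the first plateau has first coordinate \<open>0\<close>. The lateral area is the sum of the two total
  lengths, so it remains to distribute \<open>m\<close> between the two chains.
\<close>

lemma num_plateau_polycubes_eq:
  assumes "k > 0"
  shows "num_plateau_polycubes k m
    = card (SIGMA n:{0..m}. normal_chains k n \<times> normal_chains k (m - n))"
proof -
  let ?S = "{P. plateau_polycube P \<and> width P = int k \<and> lateral_area P = m}"
  define T where "T = {(Is, Js). chain_pair k Is Js \<and> fst (hd Is) = 0 \<and> fst (hd Js) = 0 \<and>
     total_length Is + total_length Js = m}"
  define f where "f = (\<lambda>(Is, Js). translation_rel `` {solid 0 Is Js})"
  have solid_S: "solid x0 Is Js \<in> ?S \<longleftrightarrow> total_length Is + total_length Js = m"
    if "chain_pair k Is Js" for x0 Is Js
    using plateau_polycube_solid[OF that assms] width_eq[OF fst_solid[OF that] assms]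
      lateral_area_solid[OF that] by simp
  have "bij_betw f T (?S // translation_rel)"
    unfolding bij_betw_def
  proof
    show "inj_on f T"
    proof (rule inj_onI, clarify)
      fix Is Js Is' Js'
      assume T: "(Is, Js) \<in> T" "(Is', Js') \<in> T" and "f (Is, Js) = f (Is', Js')"
      then have "(solid 0 Is Js, solid 0 Is' Js') \<in> translation_rel"
        unfolding f_def using equiv_translation_rel by (simp add: eq_equiv_class)
      then obtain u v w where "solid 0 Is' Js' = (+) (u, v, w) ` solid 0 Is Js"
        by (auto simp: translation_rel_def)
      then have "solid 0 Is' Js' = solid u (shift v Is) (shift w Js)"
        using T by (simp add: translate_solid T_def)
      then have *: "Is' = shift v Is \<and> Js' = shift w Js"
        using T assms solid_inject[where Is = Is' and Js = Js' and Is' = "shift v Is"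
            and Js' = "shift w Js" and k = k and k' = k]
        by (simp add: T_def interval_chain_shift)
      moreover have "Is \<noteq> []" "Js \<noteq> []" using T assms by (auto simp: T_def)
      ultimately have "v = 0" "w = 0" using T by (auto simp: T_def hd_shift)
      then show "Is = Is' \<and> Js = Js'" using * by (simp add: shift_def)
    qed
    show "f ` T = ?S // translation_rel"
    proof
      show "f ` T \<subseteq> ?S // translation_rel"
      proof clarify
        fix Is Js assume "(Is, Js) \<in> T"
        then have "solid 0 Is Js \<in> ?S" using solid_S[of Is Js 0] by (simp add: T_def)
        then show "f (Is, Js) \<in> ?S // translation_rel" unfolding f_def by (auto intro: quotientI)
      qed
      show "?S // translation_rel \<subseteq> f ` T"
      proof
        fix X assume "X \<in> ?S // translation_rel"
        then obtain P where P: "P \<in> ?S" "X = translation_rel `` {P}" by (rule quotientE)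
        then obtain x0 Is Js where c: "chain_pair k Is Js" and PS: "P = solid x0 Is Js"
          using plateau_polycube_imp_solid by blast
        define Is' where "Is' = shift (- fst (hd Is)) Is"
        define Js' where "Js' = shift (- fst (hd Js)) Js"
        have "Is \<noteq> []" "Js \<noteq> []" using c assms by auto
        then have "(Is', Js') \<in> T"
          using c P solid_S[OF c, of x0]
          by (simp add: T_def Is'_def Js'_def interval_chain_shift total_length_shift hd_shift PS)
        moreover have "solid 0 Is' Js' = (+) (- x0, - fst (hd Is), - fst (hd Js)) ` P"
          using c by (simp add: PS translate_solid Is'_def Js'_def)
        then have "(P, solid 0 Is' Js') \<in> translation_rel" by (auto simp: translation_rel_def)
        then have "f (Is', Js') = X"
          unfolding P(2) f_def by (simp add: equiv_class_eq[OF equiv_translation_rel])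
        ultimately show "X \<in> f ` T" by blast
      qed
    qed
  qed
  from bij_betw_same_card[OF this] have "num_plateau_polycubes k m = card T"
    by (simp add: num_plateau_polycubes_def)
  also have "\<dots> = card (SIGMA n:{0..m}. normal_chains k n \<times> normal_chains k (m - n))"
  proof (rule bij_betw_same_card)
    show "bij_betw (\<lambda>(Is, Js). (total_length Is, Is, Js)) T
        (SIGMA n:{0..m}. normal_chains k n \<times> normal_chains k (m - n))"
      by (rule bij_betw_byWitness[where f' = snd]) (auto simp: T_def normal_chains_def)
  qed
  finally show ?thesis .
qed

theorem theorem4p2:
  fixes k :: nat
  assumes "k \<ge> 1"
  shows "R_gf k = (C_gf (k - 1))\<^sup>2"
proof (rule fps_ext)
  fix m
  obtain j where k: "k = Suc j" using assms by (cases k) auto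
  have "R_gf k $ m = (of_nat (\<Sum>n = 0..m. card (normal_chains k n) * card (normal_chains k (m - n))))"
    using assms finite_card_normal_chains(1)
    by (simp add: R_gf_def num_plateau_polycubes_eq card_cartesian_product k)
  also have "\<dots> = (C_gf (k - 1) * C_gf (k - 1)) $ m"
    by (simp add: k fps_mult_nth finite_card_normal_chains(2))
  finally show "R_gf k $ m = ((C_gf (k - 1))\<^sup>2) $ m"
    by (simp add: power2_eq_square)
qed

end
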